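(* Let $X$ be a (real) uniformly smooth Banach space whose normalized duality mapping $J:X\to X^*$ has modulus of uniform continuity $\omega:(0,\infty)\times(0,\infty)\to(0,\infty)$. Let $C\subseteq X$ be closed and convex, let $S:C\to C$ be nonexpansive with nonempty fixed point set, let $u,x_0\in C$, and let $M>0$ be such that $2\max\{\Vert p-x_0\Vert,\Vert p-u\Vert\}\le M$ for some fixed point $p$ of $S$. For $t\in(0,1]$ let $z_t\in C$ be the unique point with $z_t=tu+(1-t)Sz_t$, and suppose that $K$ is a rate of metastability for the sequence $(z_{1/m})_{m\ge 1}$, i.e. $$\forall\varepsilon>0\ \forall g:\mathbb N\to\mathbb N\ \exists n\le K(\varepsilon,g)\ \forall k,l\in[n,n+g(n)]\quad \Vert z_{1/k}-z_{1/l}\Vert\le\varepsilon$$ (where $n\geq 1$). Let $(\alpha_n)_{n\ge0}\subset(0,1)$ and let $R_1,R_2,R_3:(0,\infty)\to\mathbb N$ satisfy (i) for all $\varepsilon>0$ and all $n\ge R_1(\varepsilon)$: $\alpha_n\le\varepsilon$; (ii) for all $\varepsilon>0$: $\prod_{k=1}^{R_2(\varepsilon)}(1-\alpha_k)\le\varepsilon$; (iii) for all $\varepsilon>0$ and all $n\ge R_3(\varepsilon)$ with $n\ge1$: $|\alpha_n-\alpha_{n-1}|\le\varepsilon\alpha_n$. Let $E:\mathbb N\to(0,\infty)$ satisfy $0<E(k)\le\prod_{n=0}^{k}(1-\alpha_n)$ for all $k\in\mathbb N$. Then the sequence $(x_n)$ generated from $x_0$ by $$x_{n+1}:=\alpha_nu+(1-\alpha_n)Sx_n$$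 converges strongly to a fixed point of $S$. Moreover, $$\forall\varepsilon>0\ \forall g:\mathbb N\to\mathbb N\ \exists n\le\Sigma\ \forall k,l\in[n,n+g(n)]\quad \Vert x_k-x_l\Vert\le\varepsilon,$$ where $\Sigma=\Sigma(\varepsilon,g,M,K,E,R_1,R_2,R_3,\omega)$ is defined by $$\Sigma:=\max\left\{R_2\left(\frac{E(k)\,\varepsilon^2}{12M^2}\right):\ \tilde\Gamma\le k\le\Gamma\right\}$$ with $$\Gamma:=\max\{\varphi(k): m_0\le k\le K(\varepsilon_0,f^* )+m_0\},\qquad \tilde\Gamma:=\min\{\varphi(k): m_0\le k\le K(\varepsilon_0,f^* )+m_0\},$$ $$\varepsilon_0:=\min\{\delta,\omega(M,\delta)\},\quad \delta:=\frac{\varepsilon^2}{144M},\quad m_0:=\left\lceil\frac{72M^2}{\varepsilon^2}\right\rceil,$$ $$\varphi(k):=\psi\left(\frac{\varepsilon^2}{72Mk}\right),\quad \tilde E(k):=E(\varphi(k)),\quad g^*(k):=k+g(k),\quad f^*(k):=f(k+m_0)+m_0,$$ $$f(k):=\left\lceil\max\left\{24M^2\cdot\frac{\max\left\{g^*\left(R_2\left(\frac{\tilde E(k)\,\varepsilon^2}{12M^2}\right)\right),\varphi(k)+1\right\}-\varphi(k)-1}{\varepsilon^2}-k,\ 0\right\}\right\rceil,$$ and, for every $\eta>0$, $$\psi(\eta):=\max\left\{R_1\left(\frac{\eta}{2M}\right),\ R_2\left(\frac{\eta\, D(\eta/2)}{6M}\right),\ R_3\left(\frac{\eta}{6M}\right)\right\},\qquad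 D(\eta):=E\left(R_3\left(\frac{\eta}{3M}\right)\right).$$
   Context: A Banach space $X$ is uniformly smooth if $\lim_{t\to0}(\Vert x+ty\Vert-\Vert x\Vert)/t$ exists uniformly in $x,y$ in the unit sphere. The normalized duality mapping is $J(x)=\{x^*\in X^*:\langle x,x^*\rangle=\Vert x\Vert^2=\Vert x^*\Vert^2\}$; in a uniformly smooth Banach space it is single-valued and norm-to-norm uniformly continuous on bounded sets. A modulus of (uniform) continuity for $J$ is a map $\omega:(0,\infty)\times(0,\infty)\to(0,\infty)$ such that for all $M,\varepsilon>0$: $\Vert x\Vert,\Vert y\Vert\le M$ and $\Vert x-y\Vert<\omega(M,\varepsilon)$ imply $\Vert J(x)-J(y)\Vert<\varepsilon$. A map $S:C\to C$ is nonexpansive if $\Vert Sx-Sy\Vert\le\Vert x-y\Vert$ for all $x,y\in C$. For $n,m\in\mathbb N$, $[n,n+m]$ denotes the integer interval $\{n,n+1,\dots,n+m\}$. The functional $K$ maps pairs $(\varepsilon,g)$ with $\varepsilon>0$, $g:\mathbb N\to\mathbb N$ to natural numbers; the variables $k$ in the definitions of $\Sigma,\Gamma,\tilde\Gamma$ range over natural numbers. *)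

theory Defs
  imports "HOL-Analysis.Analysis"
begin

definition uniformly_smooth :: "'a::real_normed_vector itself \<Rightarrow> bool" where
  "uniformly_smooth (_ :: 'a itself) \<longleftrightarrow>
     (\<exists>L. uniform_limit (sphere (0::'a) 1 \<times> sphere 0 1)
            (\<lambda>t (x, y). (norm (x + t *\<^sub>R y) - norm x) / t) L (at (0::real)))"

definition duality_set :: "'a::real_normed_vector \<Rightarrow> ('a \<Rightarrow>\<^sub>L real) set" where
  "duality_set x = {j. blinfun_apply j x = (norm x)\<^sup>2 \<and> (norm x)\<^sup>2 = (norm j)\<^sup>2}"

text \<open>The duality mapping as a function. It is meaningful only where \<open>duality_set x\<close> is a
  singleton; the lemma \<open>duality_set_uniformly_smooth\<close> below shows that this is the case for
  every \<open>x\<close> of a uniformly smooth space.\<close>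

definition duality_map :: "'a::real_normed_vector \<Rightarrow> ('a \<Rightarrow>\<^sub>L real)" where
  "duality_map x = the_elem (duality_set x)"

definition uc_modulus :: "('a::real_normed_vector \<Rightarrow> 'b::real_normed_vector) \<Rightarrow> (real \<Rightarrow> real \<Rightarrow> real) \<Rightarrow> bool" where
  "uc_modulus F \<omega> \<longleftrightarrow> (\<forall>M>0. \<forall>\<epsilon>>0. \<omega> M \<epsilon> > 0 \<and>
     (\<forall>x y. norm x \<le> M \<longrightarrow> norm y \<le> M \<longrightarrow> norm (x - y) < \<omega> M \<epsilon> \<longrightarrow> norm (F x - F y) < \<epsilon>))"

lemma filterlim_scale_at_0:
  fixes c :: real
  assumes "c \<noteq> 0"
  shows "filterlim (\<lambda>t. c * t) (at 0) (at 0)"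
proof -
  have "((\<lambda>t. c * t) \<longlongrightarrow> 0) (at 0)"
    using tendsto_mult_left[OF tendsto_ident_at, of c 0 UNIV] by simp
  then show ?thesis
    using assms by (simp add: filterlim_at eventually_at_filter)
qed

lemma smooth_direction_limit:
  fixes e y :: "'a::real_normed_vector"
  assumes us: "uniformly_smooth TYPE('a)" and e: "norm e = 1"
  shows "\<exists>d. ((\<lambda>t. (norm (e + t *\<^sub>R y) - 1) / t) \<longlongrightarrow> d) (at (0::real))"
proof (cases "y = 0")
  case True
  then show ?thesis using e by auto
next
  case False
  obtain L where L: "uniform_limit (sphere (0::'a) 1 \<times> sphere 0 1)
            (\<lambda>t (x, y). (norm (x + t *\<^sub>R y) - norm x) / t) L (at (0::real))"
    using us unfolding uniformly_smooth_def by blast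
  let ?v = "y /\<^sub>R norm y"
  have "((\<lambda>t. (norm (e + t *\<^sub>R ?v) - 1) / t) \<longlongrightarrow> L (e, ?v)) (at 0)"
    using tendsto_uniform_limitI[OF L, of "(e, ?v)"] e False by (simp add: dist_norm)
  moreover have "filterlim (\<lambda>t. norm y * t) (at 0) (at (0::real))"
    using False by (simp add: filterlim_scale_at_0)
  ultimately have "((\<lambda>t. (norm (e + (norm y * t) *\<^sub>R ?v) - 1) / (norm y * t)) \<longlongrightarrow> L (e, ?v)) (at 0)"
    by (rule filterlim_compose)
  then have "((\<lambda>t. norm y * ((norm (e + (norm y * t) *\<^sub>R ?v) - 1) / (norm y * t))) \<longlongrightarrow> norm y * L (e, ?v)) (at 0)"
    by (rule tendsto_mult_left)
  moreover have "norm y * t * inverse (norm y) = t" for t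
    using False by simp
  ultimately show ?thesis using False by auto
qed

lemma duality_set_uniformly_smooth:
  fixes x :: "'a::real_normed_vector"
  assumes us: "uniformly_smooth TYPE('a)"
  shows "duality_set x = {duality_map x}"
proof -
  have "\<exists>j. duality_set x = {j}"
  proof (cases "x = 0")
    case True
    then have "duality_set x = {0}" by (auto simp: duality_set_def)
    then show ?thesis by blast
  next
    case False
    define r where "r = norm x"
    define e where "e = x /\<^sub>R r"
    have r: "r > 0" and e: "norm e = 1" and x: "x = r *\<^sub>R e"
      using False by (auto simp: r_def e_def)
    have "\<forall>y. \<exists>d. ((\<lambda>t. (norm (e + t *\<^sub>R y) - 1) / t) \<longlongrightarrow> d) (at (0::real))"
      using smooth_direction_limit[OF us e] by blast
    from choice[OF this]
    obtain d where d: "\<And>y. ((\<lambda>t. (norm (e + t *\<^sub>R y) - 1) / t) \<longlongrightarrow> d y) (at (0::real))"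
      by blast
    have hom: "d (c *\<^sub>R y) = c * d y" for c y
    proof (cases "c = 0")
      case True
      then show ?thesis using d[of 0] e by (simp add: tendsto_const_iff)
    next
      case False
      have "filterlim (\<lambda>t. c * t) (at 0) (at (0::real))"
        using False by (simp add: filterlim_scale_at_0)
      from filterlim_compose[OF d[of y] this]
      have "((\<lambda>t. c * ((norm (e + (c * t) *\<^sub>R y) - 1) / (c * t))) \<longlongrightarrow> c * d y) (at 0)"
        by (rule tendsto_mult_left)
      then have "((\<lambda>t. (norm (e + t *\<^sub>R (c *\<^sub>R y)) - 1) / t) \<longlongrightarrow> c * d y) (at 0)"
        using False by (simp add: mult.commute)
      then show ?thesis using d[of "c *\<^sub>R y"] LIM_unique by blast
    qed
    have dr: "((\<lambda>t. (norm (e + t *\<^sub>R y) - 1) / t) \<longlongrightarrow> d y) (at_right (0::real))" for y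
      using d by (rule filterlim_mono) (auto simp: at_le)
    have arith: "(a - 1) / t \<le> ((b - 1) / t + (c - 1) / t) / 2" if "2 * a \<le> b + c" "t > 0" for a b c t :: real
    proof -
      have "(a - 1) / t \<le> ((b + c) / 2 - 1) / t"
        using that by (intro divide_right_mono) auto
      also have "\<dots> = ((b - 1) / t + (c - 1) / t) / 2"
        using that by (simp add: field_simps)
      finally show ?thesis .
    qed
    have sub: "d (y + z) \<le> d y + d z" for y z
    proof -
      have "(norm (e + t *\<^sub>R (y + z)) - 1) / t
          \<le> ((norm (e + t *\<^sub>R (2 *\<^sub>R y)) - 1) / t + (norm (e + t *\<^sub>R (2 *\<^sub>R z)) - 1) / t) / 2"
        if "t > 0" for t
      proof -
        have "2 *\<^sub>R (e + t *\<^sub>R (y + z)) = (e + t *\<^sub>R (2 *\<^sub>R y)) + (e + t *\<^sub>R (2 *\<^sub>R z))"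
          by (simp only: scaleR_2 scaleR_add_right add_ac)
        then have "2 * norm (e + t *\<^sub>R (y + z)) \<le> norm (e + t *\<^sub>R (2 *\<^sub>R y)) + norm (e + t *\<^sub>R (2 *\<^sub>R z))"
          by (metis norm_scaleR norm_triangle_ineq abs_numeral)
        then show ?thesis using that by (rule arith)
      qed
      then have "eventually (\<lambda>t. (norm (e + t *\<^sub>R (y + z)) - 1) / t
          \<le> ((norm (e + t *\<^sub>R (2 *\<^sub>R y)) - 1) / t + (norm (e + t *\<^sub>R (2 *\<^sub>R z)) - 1) / t) / 2) (at_right 0)"
        by (rule eventually_mono[OF eventually_at_right_less])
      moreover have "((\<lambda>t. ((norm (e + t *\<^sub>R (2 *\<^sub>R y)) - 1) / t + (norm (e + t *\<^sub>R (2 *\<^sub>R z)) - 1) / t) / 2)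
          \<longlongrightarrow> (d (2 *\<^sub>R y) + d (2 *\<^sub>R z)) / 2) (at_right 0)"
        by (rule tendsto_divide[OF tendsto_add[OF dr dr] tendsto_const]) simp
      ultimately have "d (y + z) \<le> (d (2 *\<^sub>R y) + d (2 *\<^sub>R z)) / 2"
        using tendsto_le[OF trivial_limit_at_right_real _ dr] by blast
      then show ?thesis by (simp add: hom)
    qed
    have neg: "d (- y) = - d y" for y using hom[of "-1" y] by simp
    have add: "d (y + z) = d y + d z" for y z
      using sub[of y z] sub[of "y + z" "- z"] by (simp add: neg)
    have le: "d y \<le> norm y" for y
    proof -
      have "(norm (e + t *\<^sub>R y) - 1) / t \<le> norm y" if "t > 0" for t
        using norm_triangle_ineq[of e "t *\<^sub>R y"] that e by (simp add: field_simps)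
      then have "eventually (\<lambda>t. (norm (e + t *\<^sub>R y) - 1) / t \<le> norm y) (at_right 0)"
        by (rule eventually_mono[OF eventually_at_right_less])
      then show ?thesis by (intro tendsto_upperbound[OF dr]) auto
    qed
    have abs: "\<bar>d y\<bar> \<le> norm y" for y using le[of y] le[of "- y"] neg[of y] by simp
    have de: "d e = 1"
    proof -
      have "(norm (e + t *\<^sub>R e) - 1) / t = 1" if "t > 0" for t
      proof -
        have "e + t *\<^sub>R e = (1 + t) *\<^sub>R e" by (simp add: algebra_simps)
        then show ?thesis using that e by simp
      qed
      then have "eventually (\<lambda>t. (norm (e + t *\<^sub>R e) - 1) / t = 1) (at_right 0)"
        by (rule eventually_mono[OF eventually_at_right_less])
      then have "((\<lambda>t. (norm (e + t *\<^sub>R e) - 1) / t) \<longlongrightarrow> 1) (at_right 0)"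
        by (rule tendsto_eventually)
      with dr[of e] show ?thesis
        by (intro tendsto_unique[of "at_right (0::real)"]) auto
    qed
    have bl: "bounded_linear (\<lambda>y. r * d y)"
      by (rule bounded_linear_intro[where K = r])
         (use abs r in \<open>auto simp: add hom algebra_simps abs_mult\<close>)
    define j where "j = Blinfun (\<lambda>y. r * d y)"
    have j: "blinfun_apply j y = r * d y" for y
      using bl by (simp add: j_def bounded_linear_Blinfun_apply)
    have "norm j = r"
    proof (rule antisym)
      show "norm j \<le> r" by (rule norm_blinfun_bound) (use abs r in \<open>auto simp: j abs_mult\<close>)
      show "r \<le> norm j" using norm_blinfun[of j e] e r by (simp add: j de)
    qed
    then have "j \<in> duality_set x"
      using r e by (simp add: duality_set_def j x hom de power2_eq_square)
    moreover have "j' = j" if "j' \<in> duality_set x" for j'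
    proof (rule blinfun_eqI)
      have j'x: "blinfun_apply j' x = r\<^sup>2" and "r\<^sup>2 = (norm j')\<^sup>2"
        using that by (auto simp: duality_set_def r_def)
      then have nj: "norm j' = r" using r by (simp add: power2_eq_iff_nonneg)
      have j'e: "blinfun_apply j' e = r"
        using j'x r by (simp add: x blinfun.scaleR_right power2_eq_square)
      have ge: "blinfun_apply j' y \<le> r * d y" for y
      proof -
        have "blinfun_apply j' y / r \<le> (norm (e + t *\<^sub>R y) - 1) / t" if "t > 0" for t
        proof -
          have "r + t * blinfun_apply j' y = blinfun_apply j' (e + t *\<^sub>R y)"
            by (simp add: blinfun.add_right blinfun.scaleR_right j'e)
          also have "\<dots> \<le> r * norm (e + t *\<^sub>R y)"
            using norm_blinfun[of j' "e + t *\<^sub>R y"] nj by simp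
          finally show ?thesis using that r by (simp add: field_simps)
        qed
        then have "eventually (\<lambda>t. blinfun_apply j' y / r \<le> (norm (e + t *\<^sub>R y) - 1) / t) (at_right 0)"
          by (rule eventually_mono[OF eventually_at_right_less])
        then have "blinfun_apply j' y / r \<le> d y" by (intro tendsto_lowerbound[OF dr]) auto
        then show ?thesis using r by (simp add: field_simps)
      qed
      show "blinfun_apply j' y = blinfun_apply j y" for y
        using ge[of y] ge[of "- y"] by (simp add: j neg blinfun.minus_right)
    qed
    ultimately show ?thesis by blast
  qed
  then obtain j where "duality_set x = {j}" ..
  then show ?thesis unfolding duality_map_def by simp
qed

definition D_fn :: "real \<Rightarrow> (nat \<Rightarrow> real) \<Rightarrow> (real \<Rightarrow> nat) \<Rightarrow> real \<Rightarrow> real" where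
  "D_fn M E R\<^sub>3 \<eta> = E (R\<^sub>3 (\<eta> / (3 * M)))"

definition \<psi>_fn :: "real \<Rightarrow> (nat \<Rightarrow> real) \<Rightarrow> (real \<Rightarrow> nat) \<Rightarrow> (real \<Rightarrow> nat) \<Rightarrow> (real \<Rightarrow> nat) \<Rightarrow> real \<Rightarrow> nat" where
  "\<psi>_fn M E R\<^sub>1 R\<^sub>2 R\<^sub>3 \<eta> =
     Max {R\<^sub>1 (\<eta> / (2 * M)), R\<^sub>2 (\<eta> * D_fn M E R\<^sub>3 (\<eta> / 2) / (6 * M)), R\<^sub>3 (\<eta> / (6 * M))}"

definition \<phi>_fn :: "real \<Rightarrow> real \<Rightarrow> (nat \<Rightarrow> real) \<Rightarrow> (real \<Rightarrow> nat) \<Rightarrow> (real \<Rightarrow> nat) \<Rightarrow> (real \<Rightarrow> nat) \<Rightarrow> nat \<Rightarrow> nat" where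
  "\<phi>_fn \<epsilon> M E R\<^sub>1 R\<^sub>2 R\<^sub>3 k = \<psi>_fn M E R\<^sub>1 R\<^sub>2 R\<^sub>3 (\<epsilon>\<^sup>2 / (72 * M * real k))"

definition f_fn :: "real \<Rightarrow> (nat \<Rightarrow> nat) \<Rightarrow> real \<Rightarrow> (nat \<Rightarrow> real) \<Rightarrow> (real \<Rightarrow> nat) \<Rightarrow> (real \<Rightarrow> nat) \<Rightarrow> (real \<Rightarrow> nat) \<Rightarrow> nat \<Rightarrow> nat" where
  "f_fn \<epsilon> g M E R\<^sub>1 R\<^sub>2 R\<^sub>3 k =
     (let \<phi> = \<phi>_fn \<epsilon> M E R\<^sub>1 R\<^sub>2 R\<^sub>3;
          E' = (\<lambda>k. E (\<phi> k));
          g' = (\<lambda>k. k + g k)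
      in nat \<lceil>max (24 * M\<^sup>2 *
                 ((real (max (g' (R\<^sub>2 (E' k * \<epsilon>\<^sup>2 / (12 * M\<^sup>2)))) (\<phi> k + 1)) - real (\<phi> k) - 1) / \<epsilon>\<^sup>2)
               - real k) 0\<rceil>)"

definition \<Sigma>_fn :: "real \<Rightarrow> (nat \<Rightarrow> nat) \<Rightarrow> real \<Rightarrow> (real \<Rightarrow> (nat \<Rightarrow> nat) \<Rightarrow> nat) \<Rightarrow> (nat \<Rightarrow> real) \<Rightarrow>
    (real \<Rightarrow> nat) \<Rightarrow> (real \<Rightarrow> nat) \<Rightarrow> (real \<Rightarrow> nat) \<Rightarrow> (real \<Rightarrow> real \<Rightarrow> real) \<Rightarrow> nat" where
  "\<Sigma>_fn \<epsilon> g M K E R\<^sub>1 R\<^sub>2 R\<^sub>3 \<omega> =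
     (let \<delta> = \<epsilon>\<^sup>2 / (144 * M);
          \<epsilon>\<^sub>0 = min \<delta> (\<omega> M \<delta>);
          m\<^sub>0 = nat \<lceil>72 * M\<^sup>2 / \<epsilon>\<^sup>2\<rceil>;
          \<phi> = \<phi>_fn \<epsilon> M E R\<^sub>1 R\<^sub>2 R\<^sub>3;
          f' = (\<lambda>k. f_fn \<epsilon> g M E R\<^sub>1 R\<^sub>2 R\<^sub>3 (k + m\<^sub>0) + m\<^sub>0);
          \<Gamma> = Max (\<phi> ` {m\<^sub>0..K \<epsilon>\<^sub>0 f' + m\<^sub>0});
          \<Gamma>' = Min (\<phi> ` {m\<^sub>0..K \<epsilon>\<^sub>0 f' + m\<^sub>0})
      in Max ((\<lambda>k. R\<^sub>2 (E k * \<epsilon>\<^sup>2 / (12 * M\<^sup>2))) ` {\<Gamma>'..\<Gamma>}))"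

end

theory Submission imports Defs begin

text \<open>
  Asymptotic regularity of \<open>x\<close> with rate \<open>\<psi>\<close> gives, by testing the equation of \<open>z\<^bsub>1/k\<^esub>\<close> against the
  duality map, \<open>\<langle>u - z\<^bsub>1/k\<^esub>, J (x\<^sub>n - z\<^bsub>1/k\<^esub>)\<rangle> \<le> \<epsilon>\<^sup>2/72\<close> for \<open>n \<ge> \<phi> k\<close>. The metastability of
  \<open>z\<close> supplies indices \<open>k\<close> and \<open>l = k + f k\<close> with \<open>z\<^bsub>1/k\<^esub>\<close> and \<open>z\<^bsub>1/l\<^esub>\<close> so close that this bound
  carries over to \<open>z\<^bsub>1/l\<^esub>\<close> as \<open>\<epsilon>\<^sup>2/36\<close>, while \<open>z\<^bsub>1/l\<^esub>\<close> is an \<open>M/l\<close>-approximate fixed point of \<open>S\<close>.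
  Hence \<open>D\<^sub>n = \<parallel>x\<^sub>n - z\<^bsub>1/l\<^esub>\<parallel>\<^sup>2\<close> satisfies
  \<open>D\<^bsub>n+1\<^esub> \<le> (1 - \<alpha>\<^sub>n) D\<^sub>n + \<alpha>\<^sub>n \<epsilon>\<^sup>2/18 + 2M\<^sup>2/l\<close> for \<open>n > \<phi> k\<close>; the size of \<open>l\<close> keeps the accumulated
  error on the relevant interval below \<open>\<epsilon>\<^sup>2/12\<close>, and the total is at most
  \<open>\<epsilon>\<^sup>2/9 + \<epsilon>\<^sup>2/12 + \<epsilon>\<^sup>2/18 = (\<epsilon>/2)\<^sup>2\<close>.
\<close>

section \<open>Inequalities for the duality mapping\<close>

lemma blinfun_le:
  fixes j :: "'a::real_normed_vector \<Rightarrow>\<^sub>L real"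
  shows "blinfun_apply j y \<le> norm j * norm y"
  using norm_blinfun[of j y] by simp

lemma
  fixes x :: "'a::real_normed_vector"
  assumes "uniformly_smooth TYPE('a)"
  shows duality_map_self: "blinfun_apply (duality_map x) x = (norm x)\<^sup>2"
    and norm_duality_map: "norm (duality_map x) = norm x"
proof -
  have "duality_map x \<in> duality_set x"
    using duality_set_uniformly_smooth[OF assms, of x] by simp
  then show "blinfun_apply (duality_map x) x = (norm x)\<^sup>2" "norm (duality_map x) = norm x"
    by (auto simp: duality_set_def power2_eq_iff_nonneg)
qed

text \<open>This is the subgradient inequality for the squared norm: testing
  \<open>duality_map (x + y)\<close> on \<open>x + y\<close> itself gives the square, and 2ab \<le>
  a^2 + b^2 absorbs the part acting on \<open>x\<close>.\<close>

lemma norm_add_power2_le_duality_map: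
  fixes x y :: "'a::real_normed_vector"
  assumes "uniformly_smooth TYPE('a)"
  shows "(norm (x + y))\<^sup>2 \<le> (norm x)\<^sup>2 + 2 * blinfun_apply (duality_map (x + y)) y"
proof -
  let ?j = "duality_map (x + y)"
  have "(norm (x + y))\<^sup>2 = blinfun_apply ?j x + blinfun_apply ?j y"
    using duality_map_self[OF assms, of "x + y"] by (simp add: blinfun.add_right)
  moreover have "blinfun_apply ?j x \<le> norm (x + y) * norm x"
    using blinfun_le[of ?j x] norm_duality_map[OF assms, of "x + y"] by simp
  moreover have "2 * (norm (x + y) * norm x) \<le> (norm (x + y))\<^sup>2 + (norm x)\<^sup>2"
    using sum_squares_bound[of "norm (x + y)" "norm x"] by (simp add: mult_ac)
  ultimately show ?thesis by linarith
qed

text \<open>Metastability yields only non-strict distances, whereas \<open>uc_modulus\<close> asks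
  for strict ones. A detour through a point of the segment costs an arbitrarily small
  \<open>e\<close>.\<close>

lemma uc_modulus_le:
  assumes \<omega>: "uc_modulus F \<omega>" and pos: "M > 0" "\<epsilon> > 0"
    and xy: "norm x \<le> M" "norm y \<le> M" "norm (x - y) \<le> \<omega> M \<epsilon>"
  shows "norm (F x - F y) \<le> \<epsilon>"
proof (rule field_le_epsilon)
  fix e :: real assume e: "e > 0"
  \<comment> \<open>Points of the segment close to \<open>y\<close> are at distance strictly less than \<open>\<omega> M \<epsilon>\<close> from \<open>x\<close>.\<close>
  have \<omega>pos: "\<omega> M \<epsilon> > 0" "\<omega> M e > 0"
    using \<omega> pos e by (auto simp: uc_modulus_def)
  \<comment> \<open>The fraction \<open>s\<close> is so small that moving by it from
    \<open>y\<close> towards \<open>x\<close> stays within \<open>\<omega> M e\<close> of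
    \<open>y\<close>; the summand 1 keeps the denominator positive when
    \<open>x = y\<close>.\<close>
  define s where "s = min 1 (\<omega> M e / (2 * (norm (x - y) + 1)))"
  have s: "0 < s" "s \<le> 1" "s * norm (x - y) < \<omega> M e"
  proof -
    have n: "norm (x - y) + 1 > 0" by (simp add: add_nonneg_pos)
    show "0 < s" "s \<le> 1" using \<omega>pos n by (auto simp: s_def)
    have "s * norm (x - y) \<le> \<omega> M e / (2 * (norm (x - y) + 1)) * norm (x - y)"
      by (intro mult_right_mono) (auto simp: s_def)
    also have "\<dots> < \<omega> M e"
    proof -
      have "\<omega> M e * norm (x - y) < \<omega> M e * (2 * (norm (x - y) + 1))"
        using \<omega>pos by (intro mult_strict_left_mono) (auto intro: add_nonneg_pos)
      then show ?thesis using n by (simp add: field_simps)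
    qed
    finally show "s * norm (x - y) < \<omega> M e" .
  qed
  define w where "w = (1 - s) *\<^sub>R y + s *\<^sub>R x"
  have "norm w \<le> (1 - s) * norm y + s * norm x"
    using norm_triangle_ineq[of "(1 - s) *\<^sub>R y" "s *\<^sub>R x"] s by (simp add: w_def)
  also have "\<dots> \<le> (1 - s) * M + s * M"
    using s xy by (intro add_mono mult_left_mono) auto
  finally have w: "norm w \<le> M" by (simp add: algebra_simps)
  have "x - w = (1 - s) *\<^sub>R (x - y)" "w - y = s *\<^sub>R (x - y)"
    by (simp_all add: w_def algebra_simps)
  then have dw: "norm (x - w) = (1 - s) * norm (x - y)" "norm (w - y) = s * norm (x - y)"
    using s by simp_all
  have "norm (x - w) < \<omega> M \<epsilon>"
  proof (cases "x = y")
    case True then show ?thesis using dw \<omega>pos by simp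
  next
    case False
    then have "(1 - s) * norm (x - y) < 1 * norm (x - y)"
      using s by (intro mult_strict_right_mono) auto
    then show ?thesis using dw xy by simp
  qed
  then have "norm (F x - F w) < \<epsilon>" using \<omega> pos xy w by (simp add: uc_modulus_def)
  moreover have "norm (F w - F y) < e" using \<omega> pos e xy w s dw by (simp add: uc_modulus_def)
  ultimately show "norm (F x - F y) \<le> \<epsilon> + e"
    using norm_triangle_ineq[of "F x - F w" "F w - F y"] by simp
qed

section \<open>Real recursions and metastability in general\<close>

text \<open>Since \<open>c\<close> enters through convex combinations, it is paid only once, however
  long the recursion runs; \<open>b\<close> carries no weight and accumulates at every step.\<close>

lemma convex_combination_recursion_bound:
  fixes a \<alpha> :: "nat \<Rightarrow> real"
  assumes \<alpha>: "\<And>n. 0 \<le> \<alpha> n \<and> \<alpha> n \<le> 1" and b: "0 \<le> b" and c: "0 \<le> c"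
    and rec: "\<And>n. N \<le> n \<Longrightarrow> a (Suc n) \<le> (1 - \<alpha> n) * a n + \<alpha> n * c + b"
    and n: "N \<le> n"
  shows "a n \<le> (\<Prod>k=N..<n. 1 - \<alpha> k) * a N + c + real (n - N) * b"
  using n
proof (induction n rule: dec_induct)
  case base
  then show ?case using c by simp
next
  case (step n)
  let ?P = "\<Prod>k=N..<n. 1 - \<alpha> k"
  have "a (Suc n) \<le> (1 - \<alpha> n) * a n + \<alpha> n * c + b" using rec step by simp
  also have "\<dots> \<le> (1 - \<alpha> n) * (?P * a N + c + real (n - N) * b) + \<alpha> n * c + b"
    using step \<alpha> by (intro add_mono mult_left_mono) auto
  also have "\<dots> = (?P * (1 - \<alpha> n)) * a N + c + (1 - \<alpha> n) * (real (n - N) * b) + b"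
    by (simp add: algebra_simps)
  also have "\<dots> \<le> (?P * (1 - \<alpha> n)) * a N + c + 1 * (real (n - N) * b) + b"
    using \<alpha> b by (intro add_mono order_refl mult_right_mono) auto
  also have "\<dots> = (\<Prod>k=N..<Suc n. 1 - \<alpha> k) * a N + c + real (Suc n - N) * b"
    using step by (simp add: Suc_diff_le algebra_simps)
  finally show ?case .
qed

text \<open>If \<open>x\<close> is not Cauchy, some \<open>h\<close> picks for each \<open>n\<close>
  a pair of indices beyond \<open>n\<close> whose values stay \<open>e\<close> apart. The sum of the
  two indices, taken as \<open>g n\<close>, makes the interval contain that pair.\<close>

lemma metastable_imp_Cauchy:
  fixes x :: "nat \<Rightarrow> 'a::real_normed_vector"
  assumes "\<And>\<epsilon> g. \<epsilon> > 0 \<Longrightarrow> \<exists>n. \<forall>k\<in>{n..n + g n}. \<forall>l\<in>{n..n + g n}. norm (x k - x l) \<le> \<epsilon>"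
  shows "Cauchy x"
proof (rule ccontr)
  assume "\<not> Cauchy x"
  then obtain e where e: "e > 0" "\<And>n. \<exists>k\<ge>n. \<exists>l\<ge>n. \<not> norm (x k - x l) < e"
    unfolding Cauchy_iff by blast
  then have "\<forall>n. \<exists>kl. fst kl \<ge> n \<and> snd kl \<ge> n \<and> norm (x (fst kl) - x (snd kl)) \<ge> e"
    by (metis fst_conv snd_conv not_less)
  then obtain h where h: "\<And>n. fst (h n) \<ge> n \<and> snd (h n) \<ge> n \<and> norm (x (fst (h n)) - x (snd (h n))) \<ge> e"
    by metis
  obtain n where "\<forall>k\<in>{n..n + (fst (h n) + snd (h n))}. \<forall>l\<in>{n..n + (fst (h n) + snd (h n))}.
      norm (x k - x l) \<le> e / 2"
    using assms[of "e / 2" "\<lambda>n. fst (h n) + snd (h n)"] e(1) by auto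
  then have "norm (x (fst (h n)) - x (snd (h n))) \<le> e / 2" using h[of n] by simp
  then show False using h[of n] e(1) by linarith
qed

section \<open>The Halpern iteration: an invariant bounded set and one-step estimates\<close>

locale halpern_iteration =
  fixes C :: "'a::banach set" and S :: "'a \<Rightarrow> 'a" and u p :: 'a and M :: real
    and \<alpha> :: "nat \<Rightarrow> real" and x :: "nat \<Rightarrow> 'a"
  assumes convex: "convex C"
    and S_maps: "S ` C \<subseteq> C"
    and S_nonexp: "\<And>v w. v \<in> C \<Longrightarrow> w \<in> C \<Longrightarrow> norm (S v - S w) \<le> norm (v - w)"
    and p: "p \<in> C" "S p = p"
    and u: "u \<in> C"
    and x0: "x 0 \<in> C"
    and M_pos: "M > 0"
    and M_bound: "norm (x 0 - p) \<le> M / 2" "norm (u - p) \<le> M / 2"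
    and \<alpha>: "\<And>n. 0 < \<alpha> n" "\<And>n. \<alpha> n < 1"
    and x_Suc: "\<And>n. x (Suc n) = \<alpha> n *\<^sub>R u + (1 - \<alpha> n) *\<^sub>R S (x n)"
begin

text \<open>All points of the argument live in this convex \<open>S\<close>-invariant set; its
  diameter is at most \<open>M\<close>, which is where every bound by \<open>M\<close> comes
  from.\<close>

definition B :: "'a set" where "B = C \<inter> cball p (M / 2)"

lemma B_iff: "v \<in> B \<longleftrightarrow> v \<in> C \<and> norm (v - p) \<le> M / 2"
  by (auto simp: B_def dist_norm norm_minus_commute)

lemma S_in_B: "v \<in> B \<Longrightarrow> S v \<in> B"
  using S_nonexp[of v p] p S_maps unfolding B_iff by fastforce

lemma u_in_B: "u \<in> B"
  using u M_bound by (simp add: B_iff)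

lemma x_in_B: "x n \<in> B"
proof (induction n)
  case 0
  then show ?case using x0 M_bound by (simp add: B_iff)
next
  case (Suc n)
  have "convex B" unfolding B_def using convex by (intro convex_Int) auto
  then show ?case
    unfolding x_Suc using Suc \<alpha>[of n] u_in_B S_in_B by (intro convexD) auto
qed

lemma B_norm_diff: "v \<in> B \<Longrightarrow> w \<in> B \<Longrightarrow> norm (v - w) \<le> M"
  using norm_triangle_ineq4[of "v - p" "w - p"] by (simp add: B_iff)

text \<open>\<open>w - p\<close> is a convex combination of \<open>u - p\<close> and
  \<open>S w - S p\<close>; nonexpansiveness lets the second term be absorbed on the left, and
  \<open>t\<close> cancels.\<close>

lemma resolvent_in_B:
  assumes t: "0 < t" "t \<le> 1" and w: "w \<in> C" "w = t *\<^sub>R u + (1 - t) *\<^sub>R S w"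
  shows "w \<in> B"
proof -
  have "w - p = t *\<^sub>R (u - p) + (1 - t) *\<^sub>R (S w - S p)"
    using w(2) p(2) by (simp add: algebra_simps)
  then have "norm (w - p) \<le> t * norm (u - p) + (1 - t) * norm (S w - S p)"
    using norm_triangle_ineq[of "t *\<^sub>R (u - p)" "(1 - t) *\<^sub>R (S w - S p)"] t by simp
  also have "\<dots> \<le> t * (M / 2) + (1 - t) * norm (w - p)"
    using t M_bound S_nonexp[OF w(1) p(1)] by (intro add_mono mult_left_mono) auto
  finally have "t * norm (w - p) \<le> t * (M / 2)" by (simp add: algebra_simps)
  then show ?thesis using t w by (simp add: B_iff)
qed

text \<open>The resolvent equation turns \<open>t *\<^sub>R (u - w)\<close> into a multiple of
  \<open>w - S w\<close>. Under \<open>duality_map (v - w)\<close> the part \<open>S v - S w\<close>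
  contributes at most \<open>d\<^sup>2\<close>, which the part \<open>v - w\<close> cancels, so only
  the error \<open>v - S v\<close> remains.\<close>

lemma resolvent_variational_bound:
  assumes smooth: "uniformly_smooth TYPE('a)"
    and t: "0 < t" "t \<le> 1" and w: "w \<in> C" "w = t *\<^sub>R u + (1 - t) *\<^sub>R S w"
    and v: "v \<in> B" "norm (v - S v) \<le> e"
  shows "blinfun_apply (duality_map (v - w)) (u - w) \<le> e * M / t"
proof -
  define j where "j = duality_map (v - w)"
  define d where "d = norm (v - w)"
  have wB: "w \<in> B" using resolvent_in_B[OF t w] .
  have d: "0 \<le> d" "d \<le> M" using B_norm_diff[OF v(1) wB] by (auto simp: d_def)
  have nj: "norm j = d" and jself: "blinfun_apply j (v - w) = d\<^sup>2"
    using norm_duality_map[OF smooth] duality_map_self[OF smooth] by (simp_all add: j_def d_def)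
  have "t *\<^sub>R (u - w) = (1 - t) *\<^sub>R ((S v - S w) + (v - S v) - (v - w))"
    using w(2) by (simp add: algebra_simps)
  then have "t * blinfun_apply j (u - w)
      = (1 - t) * (blinfun_apply j (S v - S w) + blinfun_apply j (v - S v) - d\<^sup>2)"
    by (metis blinfun.scaleR_right blinfun.add_right blinfun.diff_right jself real_scaleR_def)
  also have "\<dots> \<le> (1 - t) * (d\<^sup>2 + M * e - d\<^sup>2)"
  proof -
    have "blinfun_apply j (S v - S w) \<le> d * norm (S v - S w)"
      using blinfun_le[of j "S v - S w"] nj by simp
    also have "\<dots> \<le> d * d"
      using S_nonexp[of v w] v(1) wB d by (intro mult_left_mono) (auto simp: d_def B_iff)
    finally have 1: "blinfun_apply j (S v - S w) \<le> d\<^sup>2" by (simp add: power2_eq_square)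
    have "blinfun_apply j (v - S v) \<le> d * norm (v - S v)"
      using blinfun_le[of j "v - S v"] nj by simp
    also have "\<dots> \<le> M * e" using v d by (intro mult_mono) auto
    finally show ?thesis using 1 t by (intro mult_left_mono) auto
  qed
  also have "\<dots> \<le> M * e"
  proof -
    have "0 \<le> M * e" using M_pos order_trans[OF norm_ge_zero v(2)] by simp
    then show ?thesis using t mult_right_mono[of "1 - t" 1 "M * e"] by simp
  qed
  finally show ?thesis using t by (simp add: j_def field_simps)
qed

text \<open>The product up to \<open>n\<close> is head times tail, and the head is at least
  \<open>e\<close> because all factors lie in [0,1]; dividing by \<open>e\<close> bounds the tail.
  The last factor is kept apart so that it can be either absorbed or estimated.\<close>

lemma prod_tail_bound:
  assumes mn: "m < n" and mN: "m \<le> N" and e: "0 < e" "e \<le> (\<Prod>k=0..N. 1 - \<alpha> k)"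
    and "(\<Prod>k=1..n. 1 - \<alpha> k) \<le> e * c"
  shows "(\<Prod>k=Suc m..<n. 1 - \<alpha> k) * (1 - \<alpha> n) \<le> c"
proof -
  let ?T = "(\<Prod>k=Suc m..<n. 1 - \<alpha> k) * (1 - \<alpha> n)"
  have le1: "0 \<le> 1 - \<alpha> k \<and> 1 - \<alpha> k \<le> 1" for k using \<alpha>[of k] by simp
  have T: "0 \<le> ?T" by (intro mult_nonneg_nonneg prod_nonneg) (use le1 in auto)
  have "{0..N} = {1..m} \<union> ({0} \<union> {Suc m..N})" using mN by auto
  then have "(\<Prod>k=0..N. 1 - \<alpha> k) = (\<Prod>k=1..m. 1 - \<alpha> k) * (\<Prod>k\<in>{0} \<union> {Suc m..N}. 1 - \<alpha> k)"
    by (simp only:, subst prod.union_disjoint) auto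
  also have "\<dots> \<le> (\<Prod>k=1..m. 1 - \<alpha> k) * 1"
    by (intro mult_left_mono prod_le_1 prod_nonneg) (use le1 in auto)
  finally have "e * ?T \<le> (\<Prod>k=1..m. 1 - \<alpha> k) * ?T"
    using e T by (intro mult_right_mono) auto
  also have "\<dots> = (\<Prod>k=1..n. 1 - \<alpha> k)"
  proof -
    have "{1..n} = {1..m} \<union> ({Suc m..<n} \<union> {n})" using mn by auto
    then have "(\<Prod>k=1..n. 1 - \<alpha> k) = (\<Prod>k=1..m. 1 - \<alpha> k) * (\<Prod>k\<in>{Suc m..<n} \<union> {n}. 1 - \<alpha> k)"
      by (simp only:, subst prod.union_disjoint) (use mn in auto)
    then show ?thesis by (simp add: mult_ac)
  qed
  also have "\<dots> \<le> e * c" by fact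
  finally show ?thesis using e by simp
qed

lemma norm_x_step_le:
  assumes "n \<ge> 1" and "\<bar>\<alpha> n - \<alpha> (n - 1)\<bar> \<le> c * \<alpha> n"
  shows "norm (x (Suc n) - x n) \<le> (1 - \<alpha> n) * norm (x n - x (n - 1)) + \<alpha> n * (c * M)"
proof -
  obtain m where m: "n = Suc m" using assms by (cases n) auto
  \<comment> \<open>Comparing both steps at the common weight \<open>\<alpha> n\<close> isolates the
    change of weight as a multiple of \<open>u - S (x m)\<close>.\<close>
  have "x (Suc n) - x n = (\<alpha> n - \<alpha> m) *\<^sub>R (u - S (x m)) + (1 - \<alpha> n) *\<^sub>R (S (x n) - S (x m))"
    unfolding x_Suc[of n] unfolding m x_Suc[of m] by (simp add: algebra_simps)
  then have "norm (x (Suc n) - x n)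
      \<le> \<bar>\<alpha> n - \<alpha> m\<bar> * norm (u - S (x m)) + (1 - \<alpha> n) * norm (S (x n) - S (x m))"
    using norm_triangle_ineq[of "(\<alpha> n - \<alpha> m) *\<^sub>R (u - S (x m))" "(1 - \<alpha> n) *\<^sub>R (S (x n) - S (x m))"]
      \<alpha>[of n] by simp
  also have "\<dots> \<le> (c * \<alpha> n) * M + (1 - \<alpha> n) * norm (x n - x m)"
  proof (intro add_mono mult_mono mult_left_mono)
    show "norm (u - S (x m)) \<le> M" using B_norm_diff u_in_B S_in_B x_in_B by blast
    show "norm (S (x n) - S (x m)) \<le> norm (x n - x m)"
      using S_nonexp x_in_B by (simp add: B_iff)
    show "\<bar>\<alpha> n - \<alpha> m\<bar> \<le> c * \<alpha> n" using assms(2) m by simp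
    then show "0 \<le> c * \<alpha> n" using order_trans[OF abs_ge_zero] by blast
  qed (use \<alpha>[of n] in auto)
  finally show ?thesis using m by (simp add: mult_ac)
qed

text \<open>A difference of squares factors into a difference, at most \<open>e\<close>, times a
  sum, at most \<open>2 * M\<close>.\<close>

lemma norm_S_approx_fixpoint_le:
  assumes v: "v \<in> B" and w: "w \<in> B" and e: "norm (w - S w) \<le> e"
  shows "(norm (S v - w))\<^sup>2 \<le> (norm (v - w))\<^sup>2 + 2 * M * e"
proof -
  have "norm (S v - w) \<le> norm (S v - S w) + norm (w - S w)"
    using norm_triangle_ineq4[of "S v - S w" "w - S w"] by simp
  then have a: "norm (S v - w) - norm (v - w) \<le> e"
    using S_nonexp[of v w] v w e by (simp add: B_iff)
  have b: "norm (S v - w) + norm (v - w) \<le> 2 * M"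
    using B_norm_diff[OF S_in_B[OF v] w] B_norm_diff[OF v w] by simp
  have "(norm (S v - w))\<^sup>2 - (norm (v - w))\<^sup>2
      = (norm (S v - w) - norm (v - w)) * (norm (S v - w) + norm (v - w))"
    by (simp add: power2_eq_square algebra_simps)
  also have "\<dots> \<le> e * (norm (S v - w) + norm (v - w))"
    using a by (intro mult_right_mono) auto
  also have "\<dots> \<le> e * (2 * M)"
    using b order_trans[OF norm_ge_zero e] by (intro mult_left_mono) auto
  finally show ?thesis by (simp add: mult_ac)
qed

lemma norm_power2_x_Suc_le:
  assumes smooth: "uniformly_smooth TYPE('a)" and w: "w \<in> B" and e: "norm (w - S w) \<le> e"
    and c: "blinfun_apply (duality_map (x (Suc n) - w)) (u - w) \<le> c"
  shows "(norm (x (Suc n) - w))\<^sup>2 \<le> (1 - \<alpha> n) * (norm (x n - w))\<^sup>2 + \<alpha> n * (2 * c) + 2 * M * e"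
proof -
  have eq: "x (Suc n) - w = (1 - \<alpha> n) *\<^sub>R (S (x n) - w) + \<alpha> n *\<^sub>R (u - w)"
    by (simp add: x_Suc algebra_simps)
  have "(norm (x (Suc n) - w))\<^sup>2 \<le> (1 - \<alpha> n)\<^sup>2 * (norm (S (x n) - w))\<^sup>2
      + 2 * (\<alpha> n * blinfun_apply (duality_map (x (Suc n) - w)) (u - w))"
    using norm_add_power2_le_duality_map[OF smooth, of "(1 - \<alpha> n) *\<^sub>R (S (x n) - w)" "\<alpha> n *\<^sub>R (u - w)"]
    by (simp add: eq[symmetric] power_mult_distrib blinfun.scaleR_right)
  \<comment> \<open>Here (1 - \<alpha>)^2 \<le> 1 - \<alpha> restores a convex combination, and
    \<open>S (x n)\<close> is replaced by \<open>x n\<close> at the price of the approximate fixed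
    point error.\<close>
  also have "\<dots> \<le> (1 - \<alpha> n) * ((norm (x n - w))\<^sup>2 + 2 * M * e) + 2 * (\<alpha> n * c)"
    using \<alpha>[of n] c norm_S_approx_fixpoint_le[OF x_in_B w e, of n]
    by (intro add_mono mult_mono mult_left_mono) (auto simp: power2_eq_square mult_left_le)
  also have "\<dots> \<le> (1 - \<alpha> n) * (norm (x n - w))\<^sup>2 + \<alpha> n * (2 * c) + 2 * M * e"
  proof -
    have "0 \<le> \<alpha> n * (2 * M * e)"
      using \<alpha>[of n] M_pos order_trans[OF norm_ge_zero e] by simp
    then show ?thesis by (simp add: algebra_simps)
  qed
  finally show ?thesis .
qed

end

section \<open>Asymptotic regularity from the given rates\<close>

locale halpern_iteration_rates = halpern_iteration C S u p M \<alpha> x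
  for C :: "'a::banach set" and S u p M \<alpha> x +
  fixes R\<^sub>1 R\<^sub>2 R\<^sub>3 :: "real \<Rightarrow> nat" and E :: "nat \<Rightarrow> real"
  assumes R\<^sub>1: "\<And>\<epsilon> n. \<epsilon> > 0 \<Longrightarrow> n \<ge> R\<^sub>1 \<epsilon> \<Longrightarrow> \<alpha> n \<le> \<epsilon>"
    and R\<^sub>2: "\<And>\<epsilon>. \<epsilon> > 0 \<Longrightarrow> (\<Prod>k=1..R\<^sub>2 \<epsilon>. 1 - \<alpha> k) \<le> \<epsilon>"
    and R\<^sub>3: "\<And>\<epsilon> n. \<epsilon> > 0 \<Longrightarrow> n \<ge> R\<^sub>3 \<epsilon> \<Longrightarrow> n \<ge> 1 \<Longrightarrow> \<bar>\<alpha> n - \<alpha> (n - 1)\<bar> \<le> \<epsilon> * \<alpha> n"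
    and E: "\<And>k. 0 < E k" "\<And>k. E k \<le> (\<Prod>n=0..k. 1 - \<alpha> n)"
begin

lemma E_le_1: "E k \<le> 1"
proof -
  have "(\<Prod>n=0..k. 1 - \<alpha> n) \<le> 1" using \<alpha> by (intro prod_le_1) (auto simp: less_imp_le)
  then show ?thesis using E(2)[of k] by linarith
qed

lemma prod_le_if_ge_R\<^sub>2:
  assumes "\<epsilon> > 0" "n \<ge> R\<^sub>2 \<epsilon>"
  shows "(\<Prod>k=1..n. 1 - \<alpha> k) \<le> \<epsilon>"
proof -
  have "{1..n} = {1..R\<^sub>2 \<epsilon>} \<union> {Suc (R\<^sub>2 \<epsilon>)..n}" using assms(2) by auto
  then have "(\<Prod>k=1..n. 1 - \<alpha> k) = (\<Prod>k=1..R\<^sub>2 \<epsilon>. 1 - \<alpha> k) * (\<Prod>k=Suc (R\<^sub>2 \<epsilon>)..n. 1 - \<alpha> k)"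
    by (simp only:, subst prod.union_disjoint) auto
  also have "\<dots> \<le> (\<Prod>k=1..R\<^sub>2 \<epsilon>. 1 - \<alpha> k) * 1"
    using \<alpha> by (intro mult_left_mono prod_le_1 prod_nonneg) (auto simp: less_imp_le)
  finally show ?thesis using R\<^sub>2[OF assms(1)] by simp
qed

text \<open>The three parts of \<open>\<psi>_fn\<close> control three errors:
  \<open>R\<^sub>1\<close> bounds the distance of \<open>x (Suc n)\<close> from
  \<open>S (x n)\<close> by \<eta>/2, while \<open>R\<^sub>2\<close> and \<open>R\<^sub>3\<close>
  bound the two contributions to the step size by \<eta>/6 each.\<close>

lemma asymptotic_regularity:
  assumes \<eta>: "\<eta> > 0" and n: "n \<ge> \<psi>_fn M E R\<^sub>1 R\<^sub>2 R\<^sub>3 \<eta>"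
  shows "norm (x n - S (x n)) \<le> \<eta>"
proof (cases "\<eta> \<le> M")
  case False
  then show ?thesis using B_norm_diff[OF x_in_B S_in_B[OF x_in_B], of n n] by simp
next
  case True
  \<comment> \<open>\<open>D_fn\<close> at \<eta>/2 equals \<open>E N\<close>, so the
    \<open>R\<^sub>2\<close> part of \<open>\<psi>_fn\<close> is made for dividing out the product
    up to \<open>N\<close>.\<close>
  define N where "N = R\<^sub>3 (\<eta> / (6 * M))"
  have n1: "n \<ge> R\<^sub>1 (\<eta> / (2 * M))" and n2: "n \<ge> R\<^sub>2 (E N * (\<eta> / (6 * M)))" and n3: "n \<ge> N"
    using n by (auto simp: \<psi>_fn_def D_fn_def N_def mult_ac)
  have pos: "\<eta> / (2 * M) > 0" "\<eta> / (6 * M) > 0" using \<eta> M_pos by auto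
  have pn: "(\<Prod>k=1..n. 1 - \<alpha> k) \<le> E N * (\<eta> / (6 * M))"
    using mult_pos_pos[OF E(1) pos(2)] n2 by (rule prod_le_if_ge_R\<^sub>2)
  \<comment> \<open>The empty product at \<open>n = 0\<close> would be 1, so a bound below 1 forces
    \<open>n\<close> to be positive; this uses \<eta> \<le> M.\<close>
  have "E N * (\<eta> / (6 * M)) \<le> 1 * (1 / 6)"
    using E_le_1[of N] pos True M_pos by (intro mult_mono) (auto simp: field_simps)
  then have "(\<Prod>k=1..n. 1 - \<alpha> k) < 1" using pn by linarith
  then have n0: "n \<ge> 1" by (cases n) auto
  \<comment> \<open>With truncated subtraction \<open>Suc m\<close> is the maximum of
    \<open>N\<close> and 1: the recursion needs both the range of \<open>R\<^sub>3\<close> and a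
    predecessor index.\<close>
  define m where "m = N - 1"
  have mn: "m < n" "m \<le> N" "N \<le> Suc m" "Suc m \<le> Suc n" using n0 n3 by (auto simp: m_def)
  let ?T = "\<Prod>k=Suc m..<Suc n. 1 - \<alpha> k"
  have T: "?T \<le> \<eta> / (6 * M)"
    using prod_tail_bound[OF mn(1,2) E(1) E(2) pn] mn(1) by simp
  define a where "a k = norm (x k - x (k - 1))" for k
  have rec: "a (Suc k) \<le> (1 - \<alpha> k) * a k + \<alpha> k * (\<eta> / 6) + 0" if "Suc m \<le> k" for k
  proof -
    have "\<bar>\<alpha> k - \<alpha> (k - 1)\<bar> \<le> (\<eta> / (6 * M)) * \<alpha> k"
      using R\<^sub>3[OF pos(2), of k] that mn by (simp add: N_def)
    from norm_x_step_le[OF _ this] show ?thesis using that M_pos by (simp add: a_def)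
  qed
  have "a (Suc n) \<le> ?T * a (Suc m) + \<eta> / 6 + real (Suc n - Suc m) * 0"
    by (rule convex_combination_recursion_bound) (use \<alpha> \<eta> rec mn(4) in \<open>auto simp: less_imp_le\<close>)
  moreover have "?T * a (Suc m) \<le> \<eta> / (6 * M) * M"
    using T B_norm_diff[OF x_in_B x_in_B] pos by (intro mult_mono) (auto simp: a_def)
  ultimately have a: "norm (x (Suc n) - x n) \<le> \<eta> / 3" using M_pos by (simp add: a_def)
  have "x (Suc n) - S (x n) = \<alpha> n *\<^sub>R (u - S (x n))" by (simp add: x_Suc algebra_simps)
  then have "norm (x (Suc n) - S (x n)) = \<alpha> n * norm (u - S (x n))" using \<alpha>(1)[of n] by simp
  also have "\<dots> \<le> \<eta> / (2 * M) * M"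
    using R\<^sub>1[OF pos(1) n1] B_norm_diff[OF u_in_B S_in_B[OF x_in_B]] pos by (intro mult_mono) auto
  finally have "norm (x (Suc n) - S (x n)) \<le> \<eta> / 2" using M_pos by simp
  then show ?thesis
    using a \<eta> norm_triangle_ineq4[of "x (Suc n) - S (x n)" "x (Suc n) - x n"] by simp
qed

section \<open>Metastability of the iteration\<close>

lemma metastability:
  assumes smooth: "uniformly_smooth TYPE('a)"
    and modulus: "uc_modulus (duality_map :: 'a \<Rightarrow> 'a \<Rightarrow>\<^sub>L real) \<omega>"
    and z: "\<And>t. 0 < t \<Longrightarrow> t \<le> 1 \<Longrightarrow> z t \<in> C" "\<And>t. 0 < t \<Longrightarrow> t \<le> 1 \<Longrightarrow> z t = t *\<^sub>R u + (1 - t) *\<^sub>R S (z t)"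
    and K: "\<And>\<epsilon> g. \<epsilon> > 0 \<Longrightarrow> \<exists>n\<ge>1. n \<le> K \<epsilon> g \<and>
              (\<forall>k\<in>{n..n + g n}. \<forall>l\<in>{n..n + g n}. norm (z (1 / real k) - z (1 / real l)) \<le> \<epsilon>)"
    and \<epsilon>: "\<epsilon> > 0"
  shows "\<exists>n\<le>\<Sigma>_fn \<epsilon> g M K E R\<^sub>1 R\<^sub>2 R\<^sub>3 \<omega>. \<forall>k\<in>{n..n + g n}. \<forall>l\<in>{n..n + g n}. norm (x k - x l) \<le> \<epsilon>"
proof (cases "\<epsilon> \<le> M")
  case False
  then have "norm (x k - x l) \<le> \<epsilon>" for k l
    using B_norm_diff[OF x_in_B x_in_B, of k l] by simp
  then show ?thesis by blast
next
  case \<epsilon>M: True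
  define \<delta> where "\<delta> = \<epsilon>\<^sup>2 / (144 * M)"
  define \<epsilon>\<^sub>0 where "\<epsilon>\<^sub>0 = min \<delta> (\<omega> M \<delta>)"
  define m\<^sub>0 where "m\<^sub>0 = nat \<lceil>72 * M\<^sup>2 / \<epsilon>\<^sup>2\<rceil>"
  define \<phi> where "\<phi> = \<phi>_fn \<epsilon> M E R\<^sub>1 R\<^sub>2 R\<^sub>3"
  define f where "f = f_fn \<epsilon> g M E R\<^sub>1 R\<^sub>2 R\<^sub>3"
  define f' where "f' = (\<lambda>k. f (k + m\<^sub>0) + m\<^sub>0)"
  define I where "I = {m\<^sub>0..K \<epsilon>\<^sub>0 f' + m\<^sub>0}"
  define h where "h k = R\<^sub>2 (E k * (\<epsilon>\<^sup>2 / (12 * M\<^sup>2)))" for k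
  have \<Sigma>: "\<Sigma>_fn \<epsilon> g M K E R\<^sub>1 R\<^sub>2 R\<^sub>3 \<omega> = Max (h ` {Min (\<phi> ` I)..Max (\<phi> ` I)})"
    by (simp add: \<Sigma>_fn_def Let_def \<delta>_def \<epsilon>\<^sub>0_def m\<^sub>0_def \<phi>_def f_def f'_def I_def h_def)
  have \<delta>pos: "\<delta> > 0" using \<epsilon> M_pos by (simp add: \<delta>_def)
  have \<epsilon>\<^sub>0pos: "\<epsilon>\<^sub>0 > 0" using modulus M_pos \<delta>pos by (simp add: uc_modulus_def \<epsilon>\<^sub>0_def)
  have \<epsilon>2: "0 < \<epsilon>\<^sup>2" "\<epsilon>\<^sup>2 \<le> M\<^sup>2" using \<epsilon> \<epsilon>M by (auto intro: power_mono)
  obtain n0 where n0: "n0 \<ge> 1" "n0 \<le> K \<epsilon>\<^sub>0 f'"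
    and zn: "\<And>k l. k \<in> {n0..n0 + f' n0} \<Longrightarrow> l \<in> {n0..n0 + f' n0} \<Longrightarrow> norm (z (1 / real k) - z (1 / real l)) \<le> \<epsilon>\<^sub>0"
    using K[OF \<epsilon>\<^sub>0pos, of f'] by blast
  \<comment> \<open>The shift by \<open>m\<^sub>0\<close> inside \<open>f'\<close> makes the
    interval from \<open>n0\<close> to \<open>n0 + f' n0\<close> reach exactly to \<open>l\<close>,
    so it contains both \<open>k\<close> and \<open>l\<close>.\<close>
  define k where "k = n0 + m\<^sub>0"
  define l where "l = k + f k"
  have k: "k \<ge> 1" "k \<in> I" using n0 by (auto simp: k_def I_def)
  have l: "l \<ge> 1" using k by (simp add: l_def)
  define t where "t = 1 / real k"
  define s where "s = 1 / real l"
  have ts: "0 < t" "t \<le> 1" "0 < s" "s \<le> 1" using k l by (auto simp: t_def s_def)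
  define v where "v = z t"
  define w where "w = z s"
  have vB: "v \<in> B" and wB: "w \<in> B"
    using resolvent_in_B[OF ts(1,2) z[OF ts(1,2)]] resolvent_in_B[OF ts(3,4) z[OF ts(3,4)]]
    by (simp_all add: v_def w_def)
  have vw: "norm (v - w) \<le> \<epsilon>\<^sub>0"
    using zn[of k l] by (simp add: v_def w_def t_def s_def k_def l_def f'_def)
  define n where "n = h (\<phi> k)"
  have "n \<le> \<Sigma>_fn \<epsilon> g M K E R\<^sub>1 R\<^sub>2 R\<^sub>3 \<omega>"
    unfolding \<Sigma> n_def using k(2) by (intro Max_ge) (auto simp: I_def)
  moreover
  define G where "G = max (n + g n) (\<phi> k + 1)"
  \<comment> \<open>This is what \<open>f\<close> encodes: over at most
    \<open>G - Suc (\<phi> k)\<close> steps, errors of 2M^2/l each sum to at most \<epsilon>^2/12.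
    The maximum in \<open>G\<close> keeps the natural subtraction exact.\<close>
  have lG: "24 * M\<^sup>2 * (real (G - Suc (\<phi> k)) / \<epsilon>\<^sup>2) \<le> real l"
  proof -
    define A where "A = 24 * M\<^sup>2 * (real (G - Suc (\<phi> k)) / \<epsilon>\<^sup>2)"
    have "real (G - Suc (\<phi> k)) = real G - real (\<phi> k) - 1" by (simp add: G_def of_nat_diff)
    then have "f k = nat \<lceil>max (A - real k) 0\<rceil>"
      by (simp add: f_def f_fn_def Let_def A_def G_def n_def h_def \<phi>_def diff_diff_eq add.commute)
    then have "A - real k \<le> real (f k)" by linarith
    then show ?thesis by (simp add: A_def l_def)
  qed
  have near: "norm (x i - w) \<le> \<epsilon> / 2" if i: "i \<in> {n..n + g n}" for i
  proof -
    let ?m = "\<phi> k"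
    define \<eta> where "\<eta> = \<epsilon>\<^sup>2 / (72 * M * real k)"
    have \<eta>: "\<eta> > 0" using \<epsilon> M_pos k by (simp add: \<eta>_def)
    have \<phi>k: "\<phi> k = \<psi>_fn M E R\<^sub>1 R\<^sub>2 R\<^sub>3 \<eta>" by (simp add: \<phi>_def \<phi>_fn_def \<eta>_def)
    \<comment> \<open>A crude bound from the \<open>R\<^sub>1\<close> part of
      \<open>\<psi>_fn\<close>; it makes \<open>1 - \<alpha> i\<close> at least 3/4, which later
      turns 1/12 into 1/9.\<close>
    have \<alpha>i: "\<alpha> j \<le> 1 / 4" if "j \<ge> ?m" for j
    proof -
      have "\<alpha> j \<le> \<eta> / (2 * M)"
        using that \<eta> M_pos by (intro R\<^sub>1) (auto simp: \<phi>k \<psi>_fn_def)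
      also have "\<dots> = \<epsilon>\<^sup>2 / (144 * M\<^sup>2 * real k)" by (simp add: \<eta>_def power2_eq_square)
      also have "\<dots> \<le> M\<^sup>2 / (144 * M\<^sup>2 * 1)"
        using \<epsilon>2 k M_pos by (intro frac_le mult_left_mono) auto
      also have "\<dots> \<le> 1 / 4" using M_pos by simp
      finally show ?thesis .
    qed
    have c: "blinfun_apply (duality_map (x j - w)) (u - w) \<le> \<epsilon>\<^sup>2 / 36" if j: "j \<ge> ?m" for j
    proof -
      let ?Jv = "duality_map (x j - v)" and ?Jw = "duality_map (x j - w)"
      have "norm (x j - S (x j)) \<le> \<eta>" using asymptotic_regularity[OF \<eta>] j by (simp add: \<phi>k)
      then have 1: "blinfun_apply ?Jv (u - v) \<le> \<eta> * M / t"
        using resolvent_variational_bound[OF smooth ts(1,2) z[OF ts(1,2)] x_in_B] by (simp add: v_def)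
      have 2: "\<eta> * M / t = \<epsilon>\<^sup>2 / 72" using k M_pos by (simp add: \<eta>_def t_def)
      have "blinfun_apply ?Jv (v - w) \<le> norm ?Jv * norm (v - w)" by (rule blinfun_le)
      also have "\<dots> \<le> M * \<delta>"
        using B_norm_diff[OF x_in_B vB, of j] vw M_pos norm_duality_map[OF smooth, of "x j - v"]
        by (intro mult_mono) (auto simp: \<epsilon>\<^sub>0_def)
      finally have 3: "blinfun_apply ?Jv (v - w) \<le> M * \<delta>" .
      have "norm (?Jw - ?Jv) \<le> \<delta>"
        using B_norm_diff[OF x_in_B vB, of j] B_norm_diff[OF x_in_B wB, of j] vw
        by (intro uc_modulus_le[OF modulus M_pos \<delta>pos]) (auto simp: \<epsilon>\<^sub>0_def)
      then have "norm (?Jw - ?Jv) * norm (u - w) \<le> \<delta> * M"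
        using B_norm_diff[OF u_in_B wB] \<delta>pos by (intro mult_mono) auto
      then have 4: "blinfun_apply (?Jw - ?Jv) (u - w) \<le> M * \<delta>"
        using blinfun_le[of "?Jw - ?Jv" "u - w"] by (simp add: mult.commute)
      \<comment> \<open>Passing from \<open>v\<close> to \<open>w\<close> changes both the argument
        and the functional; each change costs \<epsilon>^2/144 on top of \<epsilon>^2/72.\<close>
      have "blinfun_apply ?Jw (u - w)
          = blinfun_apply ?Jv (u - v) + blinfun_apply ?Jv (v - w) + blinfun_apply (?Jw - ?Jv) (u - w)"
        by (simp add: blinfun.diff_left blinfun.diff_right)
      moreover have "M * \<delta> = \<epsilon>\<^sup>2 / 144" using M_pos by (simp add: \<delta>_def)
      ultimately show ?thesis using 1 2 3 4 by linarith
    qed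
    have "w - S w = s *\<^sub>R (u - S w)"
      using z(2)[OF ts(3,4)] by (simp add: w_def algebra_simps)
    then have "norm (w - S w) = s * norm (u - S w)" using ts by simp
    also have "\<dots> \<le> s * M"
      using B_norm_diff[OF u_in_B S_in_B[OF wB]] ts by (intro mult_left_mono) auto
    finally have wS: "norm (w - S w) \<le> s * M" .
    have pos: "E ?m * (\<epsilon>\<^sup>2 / (12 * M\<^sup>2)) > 0" using E(1)[of ?m] \<epsilon> M_pos by simp
    have pn: "(\<Prod>k=1..j. 1 - \<alpha> k) \<le> E ?m * (\<epsilon>\<^sup>2 / (12 * M\<^sup>2))" if "j \<ge> n" for j
      using prod_le_if_ge_R\<^sub>2[OF pos] that by (simp add: n_def h_def)
    \<comment> \<open>Otherwise \<open>n \<le> ?m\<close>, and the product up to \<open>?m\<close>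
      would already lie strictly below its own lower bound \<open>E ?m\<close>.\<close>
    have mi: "?m < i"
    proof (rule ccontr)
      assume "\<not> ?m < i"
      then have "(\<Prod>k=1..?m. 1 - \<alpha> k) \<le> E ?m * (\<epsilon>\<^sup>2 / (12 * M\<^sup>2))" using i by (intro pn) auto
      also have "\<dots> < E ?m * 1"
      proof -
        have "\<epsilon>\<^sup>2 < 12 * M\<^sup>2" using \<epsilon>2 by linarith
        then show ?thesis using E(1)[of ?m] M_pos by (intro mult_strict_left_mono) auto
      qed
      also have "\<dots> \<le> (\<Prod>k=0..?m. 1 - \<alpha> k)" using E(2)[of ?m] by simp
      also have "\<dots> = (1 - \<alpha> 0) * (\<Prod>k=1..?m. 1 - \<alpha> k)" by (simp add: prod.atLeast_Suc_atMost)
      also have "\<dots> \<le> 1 * (\<Prod>k=1..?m. 1 - \<alpha> k)"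
        using \<alpha> by (intro mult_right_mono prod_nonneg) (auto simp: less_imp_le)
      finally show False by simp
    qed
    let ?T = "\<Prod>k=Suc ?m..<i. 1 - \<alpha> k"
    have T0: "0 \<le> ?T" using \<alpha> by (intro prod_nonneg) (auto simp: less_imp_le)
    have "?T * (1 - \<alpha> i) \<le> \<epsilon>\<^sup>2 / (12 * M\<^sup>2)"
      using prod_tail_bound[OF mi order_refl E(1) E(2) pn] i by simp
    moreover have "?T * (3 / 4) \<le> ?T * (1 - \<alpha> i)"
      using \<alpha>i[of i] mi T0 by (intro mult_left_mono) auto
    ultimately have T: "?T \<le> \<epsilon>\<^sup>2 / (9 * M\<^sup>2)" by simp
    have "(norm (x i - w))\<^sup>2 \<le> ?T * (norm (x (Suc ?m) - w))\<^sup>2 + 2 * (\<epsilon>\<^sup>2 / 36)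
        + real (i - Suc ?m) * (2 * M * (s * M))"
    proof (rule convex_combination_recursion_bound[where a = "\<lambda>j. (norm (x j - w))\<^sup>2"])
      fix j assume "Suc ?m \<le> j"
      then show "(norm (x (Suc j) - w))\<^sup>2
          \<le> (1 - \<alpha> j) * (norm (x j - w))\<^sup>2 + \<alpha> j * (2 * (\<epsilon>\<^sup>2 / 36)) + 2 * M * (s * M)"
        by (intro norm_power2_x_Suc_le[OF smooth wB wS c]) simp
    qed (use \<alpha> ts M_pos mi in \<open>auto simp: less_imp_le\<close>)
    moreover have "?T * (norm (x (Suc ?m) - w))\<^sup>2 \<le> \<epsilon>\<^sup>2 / (9 * M\<^sup>2) * M\<^sup>2"
      using T B_norm_diff[OF x_in_B wB] by (intro mult_mono power_mono) auto
    moreover have "real (i - Suc ?m) * (2 * M * (s * M)) \<le> \<epsilon>\<^sup>2 / 12"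
    proof -
      have "24 * M\<^sup>2 * (real (i - Suc ?m) / \<epsilon>\<^sup>2) \<le> 24 * M\<^sup>2 * (real (G - Suc ?m) / \<epsilon>\<^sup>2)"
        using i by (intro mult_left_mono divide_right_mono) (auto simp: G_def)
      then have "24 * M\<^sup>2 * (real (i - Suc ?m) / \<epsilon>\<^sup>2) \<le> real l" using lG by linarith
      then show ?thesis using l \<epsilon> by (simp add: s_def field_simps power2_eq_square)
    qed
    ultimately have "(norm (x i - w))\<^sup>2 \<le> (\<epsilon> / 2)\<^sup>2" using M_pos by (simp add: power_divide)
    then show ?thesis using \<epsilon> by (simp add: power2_le_iff_abs_le)
  qed
  have "norm (x i - x j) \<le> \<epsilon>" if "i \<in> {n..n + g n}" "j \<in> {n..n + g n}" for i j
    using near[OF that(1)] near[OF that(2)] norm_triangle_ineq4[of "x i - w" "x j - w"] by simp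
  ultimately show ?thesis by blast
qed

end

section \<open>Strong convergence to a fixed point, with the rate of metastability\<close>

theorem theorem3p4:
  fixes \<omega> :: "real \<Rightarrow> real \<Rightarrow> real"
    and C :: "'a::banach set" and S :: "'a \<Rightarrow> 'a" and u x\<^sub>0 :: 'a and M :: real
    and z :: "real \<Rightarrow> 'a" and K :: "real \<Rightarrow> (nat \<Rightarrow> nat) \<Rightarrow> nat"
    and \<alpha> :: "nat \<Rightarrow> real" and R\<^sub>1 R\<^sub>2 R\<^sub>3 :: "real \<Rightarrow> nat" and E :: "nat \<Rightarrow> real"
    and x :: "nat \<Rightarrow> 'a"
  assumes smooth: "uniformly_smooth TYPE('a)"
    and modulus: "uc_modulus (duality_map :: 'a \<Rightarrow> 'a \<Rightarrow>\<^sub>L real) \<omega>"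
    and C: "closed C" "convex C"
    and S_maps: "S ` C \<subseteq> C"
    and S_nonexp: "\<forall>v\<in>C. \<forall>w\<in>C. norm (S v - S w) \<le> norm (v - w)"
    and S_fix: "{p \<in> C. S p = p} \<noteq> {}"
    and u: "u \<in> C" and x\<^sub>0: "x\<^sub>0 \<in> C"
    and M_pos: "M > 0"
    and M_bound: "\<exists>p\<in>C. S p = p \<and> 2 * max (norm (p - x\<^sub>0)) (norm (p - u)) \<le> M"
    and z: "\<forall>t\<in>{0<..1}. z t \<in> C \<and> z t = t *\<^sub>R u + (1 - t) *\<^sub>R S (z t)"
    and K: "\<forall>\<epsilon>>0. \<forall>g :: nat \<Rightarrow> nat. \<exists>n\<ge>1. n \<le> K \<epsilon> g \<and>
              (\<forall>k\<in>{n..n + g n}. \<forall>l\<in>{n..n + g n}. norm (z (1 / real k) - z (1 / real l)) \<le> \<epsilon>)"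
    and \<alpha>: "\<forall>n. \<alpha> n \<in> {0<..<1}"
    and R\<^sub>1: "\<forall>\<epsilon>>0. \<forall>n\<ge>R\<^sub>1 \<epsilon>. \<alpha> n \<le> \<epsilon>"
    and R\<^sub>2: "\<forall>\<epsilon>>0. (\<Prod>k=1..R\<^sub>2 \<epsilon>. 1 - \<alpha> k) \<le> \<epsilon>"
    and R\<^sub>3: "\<forall>\<epsilon>>0. \<forall>n\<ge>R\<^sub>3 \<epsilon>. n \<ge> 1 \<longrightarrow> \<bar>\<alpha> n - \<alpha> (n - 1)\<bar> \<le> \<epsilon> * \<alpha> n"
    and E: "\<forall>k. 0 < E k \<and> E k \<le> (\<Prod>n=0..k. 1 - \<alpha> n)"
    and x_0: "x 0 = x\<^sub>0"
    and x_Suc: "\<forall>n. x (Suc n) = \<alpha> n *\<^sub>R u + (1 - \<alpha> n) *\<^sub>R S (x n)"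
  shows "(\<exists>q\<in>C. S q = q \<and> x \<longlonglongrightarrow> q) \<and>
    (\<forall>\<epsilon>>0. \<forall>g :: nat \<Rightarrow> nat. \<exists>n\<le>\<Sigma>_fn \<epsilon> g M K E R\<^sub>1 R\<^sub>2 R\<^sub>3 \<omega>.
       \<forall>k\<in>{n..n + g n}. \<forall>l\<in>{n..n + g n}. norm (x k - x l) \<le> \<epsilon>)"
proof -
  obtain p where p: "p \<in> C" "S p = p" "2 * max (norm (p - x\<^sub>0)) (norm (p - u)) \<le> M"
    using M_bound by blast
  interpret halpern_iteration_rates C S u p M \<alpha> x R\<^sub>1 R\<^sub>2 R\<^sub>3 E
  proof
    show "norm (x 0 - p) \<le> M / 2" "norm (u - p) \<le> M / 2"
      using p(3) by (auto simp: x_0 norm_minus_commute)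
  qed (use assms p in \<open>auto\<close>)
  have meta: "\<exists>n\<le>\<Sigma>_fn \<epsilon> g M K E R\<^sub>1 R\<^sub>2 R\<^sub>3 \<omega>. \<forall>k\<in>{n..n + g n}. \<forall>l\<in>{n..n + g n}. norm (x k - x l) \<le> \<epsilon>"
    if "\<epsilon> > 0" for \<epsilon> g
    by (rule metastability[OF smooth modulus _ _ _ that, where z = z]) (use z K in auto)
  \<comment> \<open>Forgetting the bound on \<open>n\<close> turns metastability into the Cauchy
    property.\<close>
  have "Cauchy x"
    by (rule metastable_imp_Cauchy) (use meta in blast)
  then obtain q where q: "x \<longlonglongrightarrow> q"
    using Cauchy_convergent_iff convergent_def by blast
  have xC: "x n \<in> C" for n using x_in_B by (simp add: B_iff)
  then have qC: "q \<in> C" using closed_sequentially[OF C(1) _ q] by blast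
  have "(\<lambda>n. x n - S (x n)) \<longlonglongrightarrow> 0"
    unfolding LIMSEQ_iff
  proof (intro allI impI)
    fix r :: real assume r: "r > 0"
    show "\<exists>N. \<forall>n\<ge>N. norm (x n - S (x n) - 0) < r"
      using asymptotic_regularity[of "r / 2"] r
      by (intro exI[of _ "\<psi>_fn M E R\<^sub>1 R\<^sub>2 R\<^sub>3 (r / 2)"]) fastforce
  qed
  then have Sx: "(\<lambda>n. S (x n)) \<longlonglongrightarrow> q"
    using tendsto_diff[OF q, of "\<lambda>n. x n - S (x n)" 0] by simp
  \<comment> \<open>Nonexpansiveness on \<open>C\<close> serves as continuity of \<open>S\<close>
    along \<open>x\<close>, since \<open>q\<close> lies in the closed set \<open>C\<close>.\<close>
  have "(\<lambda>n. S (x n) - S q) \<longlonglongrightarrow> 0"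
  proof (rule Lim_null_comparison)
    show "\<forall>\<^sub>F n in sequentially. norm (S (x n) - S q) \<le> norm (x n - q)"
      using S_nonexp xC qC by simp
    show "(\<lambda>n. norm (x n - q)) \<longlonglongrightarrow> 0"
      using q by (simp add: tendsto_norm_zero_iff LIM_zero_iff)
  qed
  then have "(\<lambda>n. S (x n)) \<longlonglongrightarrow> S q" by (simp add: LIM_zero_iff)
  then have "S q = q" using Sx LIMSEQ_unique by blast
  then show ?thesis using q qC meta by blast
qed

end
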